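(* Let $p>5$ be a (rational integer) prime, let $i^2=-1$, and for each integer $k\geq 1$ define $$S_p^{(k)} = \sum_{\substack{1\leq n,m\leq p-1\\ \gcd(p,\,m^2+n^2)=1}} \frac{1}{(n+mi)^k},$$ where the sum is over all pairs of integers $(n,m)$ with $1\le n,m\le p-1$ and $m^2+n^2$ not divisible by $p$. Then the following congruences hold: (1) $S_p^{(1)} \equiv 0 \pmod{p^4}$; (2) $S_p^{(2)} \equiv 0 \pmod{p^3}$; (3) $S_p^{(3)} \equiv 0 \pmod{p^2}$; (4) $S_p^{(4)} \equiv 0 \pmod{p}$.
   Context: The sums are computed in $\mathbb{Q}(i)$. Every summand has denominator a power of a Gaussian integer whose norm $n^2+m^2$ is coprime to $p$, so the sums lie in the ring $R=\{a/b : a\in\mathbb{Z}[i],\ b\in\mathbb{Z},\ p\nmid b\}$. For $x,y\in R$, the congruence $x\equiv y \pmod{p^j}$ means $x-y\in p^jR$, i.e. $x-y=p^j a/b$ with $a\in\mathbb{Z}[i]$, $b\in\mathbb{Z}$, $p\nmid b$. *)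

theory Defs
  imports Complex_Main "HOL-Computational_Algebra.Primes"
begin

text \<open>The field of Gaussian rationals is regarded as a subfield of the complex numbers.\<close>

definition gauss_ints :: "complex set" where
  "gauss_ints = {of_int x + of_int y * \<i> | x y. True}"

definition gauss_local :: "int \<Rightarrow> complex set" where
  "gauss_local p = {a / of_int b | a b. a \<in> gauss_ints \<and> \<not> p dvd b}"

text \<open>Congruence modulo \<open>p ^ j\<close> is a relation on \<^term>\<open>gauss_local p\<close> only, so
  membership of both sides is part of the definition.\<close>

definition gauss_cong :: "int \<Rightarrow> nat \<Rightarrow> complex \<Rightarrow> complex \<Rightarrow> bool" where
  "gauss_cong p j x y \<longleftrightarrow>
     x \<in> gauss_local p \<and> y \<in> gauss_local p \<and> (\<exists>r\<in>gauss_local p. x - y = of_int (p ^ j) * r)"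

definition gauss_sum :: "int \<Rightarrow> nat \<Rightarrow> complex" where
  "gauss_sum p k =
     (\<Sum>(n, m)\<in>{(n, m). n \<in> {1..p - 1} \<and> m \<in> {1..p - 1} \<and> gcd p (m\<^sup>2 + n\<^sup>2) = 1}.
        1 / (of_int n + of_int m * \<i>) ^ k)"

end

theory Submission
  imports Defs
begin

text \<open>
  Doubling the residues \<open>(n, m)\<close> modulo \<open>p\<close> permutes the index set and multiplies
  \<open>S\<^sup>(\<^sup>4\<^sup>)\<close> by \<open>1/16\<close> modulo \<open>p\<close>, so \<open>p\<close> divides \<open>15 S\<^sup>(\<^sup>4\<^sup>)\<close>. The other congruences
  descend from this one by expanding in powers of \<open>p\<close> after a reflection of the index set.
  With \<open>z = n + m \<i>\<close>, the reflection \<open>z \<mapsto> p (1 + \<i>) - z\<close> changes the sign of the leading term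
  of \<open>1/z\<^sup>k\<close> for odd \<open>k\<close>, which expresses \<open>2 S\<^sup>(\<^sup>k\<^sup>)\<close> through the sums of higher order.
  For \<open>k = 2\<close> the reflection \<open>z \<mapsto> p - cnj z\<close> shows that \<open>S\<^sup>(\<^sup>2\<^sup>)\<close> is congruent to its conjugate,
  while exchanging \<open>n\<close> and \<open>m\<close> shows that it is the negative of its conjugate.
\<close>

section \<open>Closure properties of the Gaussian integers\<close>

lemma gauss_intsI: "of_int x + of_int y * \<i> \<in> gauss_ints"
  unfolding gauss_ints_def by blast

lemma gauss_ints_of_int: "of_int x \<in> gauss_ints"
  using gauss_intsI[of x 0] by simp

lemma gauss_ints_add:
  assumes "a \<in> gauss_ints" "b \<in> gauss_ints"
  shows "a + b \<in> gauss_ints"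
proof -
  obtain x y x' y' where "a = of_int x + of_int y * \<i>" "b = of_int x' + of_int y' * \<i>"
    using assms unfolding gauss_ints_def by blast
  then have "a + b = of_int (x + x') + of_int (y + y') * \<i>"
    by (simp add: algebra_simps)
  then show ?thesis by (metis gauss_intsI)
qed

lemma gauss_ints_mult:
  assumes "a \<in> gauss_ints" "b \<in> gauss_ints"
  shows "a * b \<in> gauss_ints"
proof -
  obtain x y x' y' where "a = of_int x + of_int y * \<i>" "b = of_int x' + of_int y' * \<i>"
    using assms unfolding gauss_ints_def by blast
  then have "a * b = of_int (x * x' - y * y') + of_int (x * y' + y * x') * \<i>"
    by (simp add: complex_eq_iff)
  then show ?thesis by (metis gauss_intsI)
qed

lemma gauss_ints_cnj:
  assumes "a \<in> gauss_ints"
  shows "cnj a \<in> gauss_ints"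
proof -
  obtain x y where "a = of_int x + of_int y * \<i>"
    using assms unfolding gauss_ints_def by blast
  then have "cnj a = of_int x + of_int (- y) * \<i>"
    by (simp add: complex_eq_iff)
  then show ?thesis by (metis gauss_intsI)
qed

section \<open>The ideals generated by powers of \<open>p\<close>, and the symmetries of the index
  set\<close>

definition gauss_ideal :: "int \<Rightarrow> nat \<Rightarrow> complex set" where
  "gauss_ideal p j = (\<lambda>r. of_int (p ^ j) * r) ` gauss_local p"

text \<open>Divisibility replaces the gcd condition of \<open>gauss_sum\<close>; for prime
  \<open>p\<close> the two agree, see \<open>gauss_sum_eq\<close>.\<close>

definition gauss_index :: "int \<Rightarrow> (int \<times> int) set" where
  "gauss_index p = {(n, m). n \<in> {1..p - 1} \<and> m \<in> {1..p - 1} \<and> \<not> p dvd m\<^sup>2 + n\<^sup>2}"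

definition gauss_of :: "int \<times> int \<Rightarrow> complex" where
  "gauss_of = (\<lambda>(n, m). of_int n + of_int m * \<i>)"

lemma gauss_of_in_gauss_ints: "gauss_of x \<in> gauss_ints"
  by (cases x) (simp add: gauss_of_def gauss_intsI)

lemma finite_gauss_index: "finite (gauss_index p)"
  by (rule finite_subset[of _ "{1..p - 1} \<times> {1..p - 1}"]) (auto simp: gauss_index_def)

lemma sum_involution:
  assumes "\<And>x. x \<in> A \<Longrightarrow> h x \<in> A" "\<And>x. x \<in> A \<Longrightarrow> h (h x) = x"
  shows "(\<Sum>x\<in>A. f (h x)) = sum f A"
  by (rule sum.reindex_bij_witness[of _ h h]) (use assms in auto)

lemma reflect_dvd_iff:
  fixes p :: int
  shows "p dvd (p - m)\<^sup>2 + n\<^sup>2 \<longleftrightarrow> p dvd m\<^sup>2 + n\<^sup>2"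
proof -
  have "(p - m)\<^sup>2 + n\<^sup>2 = (m\<^sup>2 + n\<^sup>2) + p * (p - 2 * m)"
    by (simp add: power2_eq_square algebra_simps)
  then show ?thesis by (metis dvd_add_left_iff dvd_triv_left)
qed

lemma gauss_index_swap: "(n, m) \<in> gauss_index p \<Longrightarrow> (m, n) \<in> gauss_index p"
  by (simp add: gauss_index_def add.commute)

lemma gauss_index_reflect: "(n, m) \<in> gauss_index p \<Longrightarrow> (p - n, m) \<in> gauss_index p"
  using reflect_dvd_iff[of p n m] by (simp add: gauss_index_def add.commute)

lemma gauss_index_reflect_both: "(n, m) \<in> gauss_index p \<Longrightarrow> (p - n, p - m) \<in> gauss_index p"
  by (blast intro: gauss_index_swap gauss_index_reflect)

text \<open>Closes the reflection argument for odd exponents. The factor is written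
  \<open>of_int 2\<close> to fit the shape required by \<open>ideal_cancel\<close>.\<close>

lemma double_eq_of_uminus_eq:
  fixes s t :: complex
  assumes "- s = s + t"
  shows "of_int 2 * s = - t"
proof -
  have "2 * s = - t" using assms by algebra
  then show ?thesis by simp
qed

section \<open>Exact expansions of powers of a shifted inverse\<close>

lemma shifted_inverse_rec:
  fixes z w :: complex
  assumes "z \<noteq> 0" "z - w \<noteq> 0"
  shows "1 / (z - w) = 1 / z + w * (1 / z) * (1 / (z - w))"
  using assms by (simp add: field_simps)

text \<open>Truncated geometric series, obtained by unrolling the recursion for \<open>v\<close>
  until the remainder carries \<open>w ^ 4\<close>. The remainder is a polynomial in
  \<open>u\<close> and \<open>v\<close>, so it stays in the local ring when \<open>u\<close> and
  \<open>v\<close> do.\<close>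

lemma shifted_inverse_expand1:
  fixes u v w :: complex
  assumes "v = u + w * u * v"
  shows "v = u + w * u\<^sup>2 + w\<^sup>2 * u ^ 3 + w ^ 3 * u ^ 4 + w ^ 4 * (u ^ 4 * v)"
  using assms by algebra

text \<open>The coefficients 1, 2, 3 are those of the binomial series of exponent -2, stopped before
  \<open>w ^ 3\<close>.\<close>

lemma shifted_inverse_expand2:
  fixes u v w :: complex
  assumes "v = u + w * u * v"
  shows "v\<^sup>2 = u\<^sup>2 + 2 * w * u ^ 3 + 3 * w\<^sup>2 * u ^ 4 + w ^ 3 * (3 * u ^ 4 * v + u ^ 3 * v\<^sup>2)"
  using assms by algebra

lemma shifted_inverse_expand3:
  fixes u v w :: complex
  assumes "v = u + w * u * v"
  shows "v ^ 3 = u ^ 3 + 3 * w * u ^ 4 + w\<^sup>2 * (5 * u ^ 4 * v + 2 * w * u ^ 4 * v\<^sup>2 + u\<^sup>2 * v ^ 3)"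
  using assms by algebra

locale gauss_prime =
  fixes p :: int
  assumes prime: "prime p"
begin

abbreviation R where "R \<equiv> gauss_local p"
abbreviation Id where "Id \<equiv> gauss_ideal p"
abbreviation I where "I \<equiv> gauss_index p"
abbreviation S where "S \<equiv> gauss_sum p"

section \<open>The local ring at \<open>p\<close> and its ideals\<close>

lemma gauss_sum_eq: "S k = (\<Sum>x\<in>I. (1 / gauss_of x) ^ k)"
proof -
  have "gcd p a = 1 \<longleftrightarrow> \<not> p dvd a" for a :: int
    using prime by (metis coprime_absorb_left coprime_iff_gcd_eq_1 not_prime_unit prime_imp_coprime)
  then have "I = {(n, m). n \<in> {1..p - 1} \<and> m \<in> {1..p - 1} \<and> gcd p (m\<^sup>2 + n\<^sup>2) = 1}"
    unfolding gauss_index_def by auto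
  then show ?thesis
    unfolding gauss_sum_def
    by (intro sum.cong) (auto simp: gauss_of_def power_one_over)
qed

lemma local_divide: "a \<in> gauss_ints \<Longrightarrow> \<not> p dvd b \<Longrightarrow> a / of_int b \<in> R"
  unfolding gauss_local_def by blast

lemma gauss_ints_local: "a \<in> gauss_ints \<Longrightarrow> a \<in> R"
  using local_divide[of a 1] prime not_prime_unit by auto

lemma local_of_int: "of_int x \<in> R"
  by (simp add: gauss_ints_local gauss_ints_of_int)

lemma local_numeral: "numeral k \<in> R"
  using local_of_int[of "numeral k"] by simp

lemma local_one: "1 \<in> R"
  using local_of_int[of 1] by simp

lemma local_i: "\<i> \<in> R"
  using gauss_ints_local[OF gauss_intsI[of 0 1]] by simp

lemma local_mult:
  assumes "x \<in> R" "y \<in> R"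
  shows "x * y \<in> R"
proof -
  obtain a b c d where "x = a / of_int b" "y = c / of_int d" "a \<in> gauss_ints" "c \<in> gauss_ints"
    "\<not> p dvd b" "\<not> p dvd d"
    using assms unfolding gauss_local_def by blast
  then have "x * y = (a * c) / of_int (b * d)" "a * c \<in> gauss_ints" "\<not> p dvd b * d"
    using prime by (auto simp: gauss_ints_mult prime_dvd_mult_iff)
  then show ?thesis unfolding gauss_local_def by blast
qed

lemma local_add:
  assumes "x \<in> R" "y \<in> R"
  shows "x + y \<in> R"
proof -
  obtain a b c d where *: "x = a / of_int b" "y = c / of_int d" "a \<in> gauss_ints" "c \<in> gauss_ints"
    "\<not> p dvd b" "\<not> p dvd d"
    using assms unfolding gauss_local_def by blast
  then have "b \<noteq> 0" "d \<noteq> 0" by auto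
  with * have "x + y = (a * of_int d + c * of_int b) / of_int (b * d)"
    by (simp add: field_simps)
  moreover have "a * of_int d + c * of_int b \<in> gauss_ints" "\<not> p dvd b * d"
    using * prime by (auto intro!: gauss_ints_add gauss_ints_mult gauss_ints_of_int
        simp: prime_dvd_mult_iff)
  ultimately show ?thesis unfolding gauss_local_def by blast
qed

lemma local_uminus: "x \<in> R \<Longrightarrow> - x \<in> R"
  using local_mult[OF local_of_int[of "- 1"], of x] by simp

lemma local_power: "x \<in> R \<Longrightarrow> x ^ k \<in> R"
  by (induction k) (auto intro: local_one local_mult)

lemma local_cnj:
  assumes "x \<in> R"
  shows "cnj x \<in> R"
proof -
  obtain a b where "x = a / of_int b" "a \<in> gauss_ints" "\<not> p dvd b"
    using assms unfolding gauss_local_def by blast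
  then have "cnj x = cnj a / of_int b" "cnj a \<in> gauss_ints" "\<not> p dvd b"
    by (auto simp: gauss_ints_cnj)
  then show ?thesis unfolding gauss_local_def by blast
qed

lemma local_inverse_int: "\<not> p dvd c \<Longrightarrow> 1 / of_int c \<in> R"
  using local_divide[OF gauss_ints_of_int[of 1]] by simp

lemma gauss_of_nonzero:
  assumes "x \<in> I"
  shows "gauss_of x \<noteq> 0"
  using assms by (auto simp: gauss_of_def gauss_index_def complex_eq_iff)

text \<open>Multiplying numerator and denominator by the conjugate leaves the norm as denominator,
  and the index set is exactly where \<open>p\<close> does not divide the norm.\<close>

lemma local_inverse:
  assumes "x \<in> I"
  shows "1 / gauss_of x \<in> R"
proof -
  obtain n m where x: "x = (n, m)" by (cases x)
  have nd: "\<not> p dvd m\<^sup>2 + n\<^sup>2" using assms x by (simp add: gauss_index_def)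
  have "of_int (m\<^sup>2 + n\<^sup>2) = gauss_of x * cnj (gauss_of x)"
    by (simp add: x gauss_of_def complex_eq_iff power2_eq_square)
  then have "1 / gauss_of x = cnj (gauss_of x) / of_int (m\<^sup>2 + n\<^sup>2)"
    using gauss_of_nonzero[OF assms] by simp
  then show ?thesis
    using local_divide[OF gauss_ints_cnj[OF gauss_of_in_gauss_ints] nd] by simp
qed

lemma idealI: "r \<in> R \<Longrightarrow> of_int p ^ j * r \<in> Id j"
  by (auto simp: gauss_ideal_def)

lemma idealE:
  assumes "x \<in> Id j"
  obtains r where "r \<in> R" "x = of_int p ^ j * r"
  using assms by (auto simp: gauss_ideal_def)

lemma ideal_add: "x \<in> Id j \<Longrightarrow> y \<in> Id j \<Longrightarrow> x + y \<in> Id j"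
  by (elim idealE) (simp add: idealI local_add flip: distrib_left)

lemma ideal_mult: "r \<in> R \<Longrightarrow> x \<in> Id j \<Longrightarrow> r * x \<in> Id j"
  by (elim idealE) (simp add: idealI local_mult mult.left_commute[of r])

lemma ideal_uminus: "x \<in> Id j \<Longrightarrow> - x \<in> Id j"
  by (elim idealE) (simp add: idealI local_uminus flip: mult_minus_right)

lemma ideal_cnj: "x \<in> Id j \<Longrightarrow> cnj x \<in> Id j"
  by (elim idealE) (auto intro: idealI local_cnj)

lemma ideal_sum: "(\<And>x. x \<in> A \<Longrightarrow> f x \<in> Id j) \<Longrightarrow> sum f A \<in> Id j"
proof (induction A rule: infinite_finite_induct)
  case (insert x A)
  then show ?case by (auto intro: ideal_add)
\<comment> \<open>Empty and infinite sums are 0, which is \<open>p ^ j\<close> times 0.\<close>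
qed (use idealI[OF local_of_int[of 0], of j] in auto)

lemma ideal_power_mult: "r \<in> R \<Longrightarrow> x \<in> Id j \<Longrightarrow> (of_int p * r) ^ k * x \<in> Id (k + j)"
proof (elim idealE)
  fix s assume "r \<in> R" "s \<in> R" "x = of_int p ^ j * s"
  then have "(of_int p * r) ^ k * x = of_int p ^ (k + j) * (r ^ k * s)"
    by (simp add: power_mult_distrib power_add mult_ac)
  then show ?thesis
    using \<open>r \<in> R\<close> \<open>s \<in> R\<close> by (simp only: idealI local_mult local_power)
qed

text \<open>An integer prime to \<open>p\<close> is a unit of the local ring. This removes the
  factors 2 and 15 below.\<close>

lemma ideal_cancel:
  assumes "\<not> p dvd c" "of_int c * x \<in> Id j"
  shows "x \<in> Id j"
proof -
  have "x = 1 / of_int c * (of_int c * x)" using assms(1) by auto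
  also have "\<dots> \<in> Id j" by (intro ideal_mult local_inverse_int assms)
  finally show ?thesis .
qed

text \<open>Membership of both sides in the local ring, demanded by \<open>gauss_cong\<close>,
  follows from \<open>x\<close> being \<open>p ^ j\<close> times a local element.\<close>

lemma gauss_cong_zero: "x \<in> Id j \<Longrightarrow> gauss_cong p j x 0"
  unfolding gauss_cong_def
  by (elim idealE) (use local_of_int[of 0] in \<open>auto intro: local_mult local_power local_of_int\<close>)

lemmas local_intros = local_add local_mult local_power local_uminus local_numeral local_one
  local_of_int local_cnj local_inverse

section \<open>Doubling residues, and the sum of fourth powers\<close>

lemma double_index:
  assumes "p > 2" "(n, m) \<in> I"
  shows "((2 * n) mod p, (2 * m) mod p) \<in> I"
proof -
  have two: "\<not> p dvd 2" using assms(1) zdvd_not_zless by auto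
  have res: "(2 * k) mod p \<in> {1..p - 1}" if "k \<in> {1..p - 1}" for k
  proof -
    have "\<not> p dvd 2 * k"
      using that two prime by (auto simp: prime_dvd_mult_iff zdvd_not_zless)
    then have "(2 * k) mod p \<noteq> 0" by (simp add: dvd_eq_mod_eq_0)
    moreover have "0 \<le> (2 * k) mod p" "(2 * k) mod p < p" using assms(1) by auto
    ultimately show ?thesis by auto
  qed
  have "(((2 * m) mod p)\<^sup>2 + ((2 * n) mod p)\<^sup>2) mod p = ((2 * m)\<^sup>2 + (2 * n)\<^sup>2) mod p"
    by (intro mod_add_cong) (simp_all add: power_mod)
  also have "(2 * m)\<^sup>2 + (2 * n)\<^sup>2 = 2 * 2 * (m\<^sup>2 + n\<^sup>2)"
    by (simp add: power_mult_distrib)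
  finally have "p dvd ((2 * m) mod p)\<^sup>2 + ((2 * n) mod p)\<^sup>2 \<longleftrightarrow> p dvd 2 * 2 * (m\<^sup>2 + n\<^sup>2)"
    by (simp only: dvd_eq_mod_eq_0)
  also have "\<dots> \<longleftrightarrow> p dvd m\<^sup>2 + n\<^sup>2"
    using two by (simp only: prime_dvd_mult_iff[OF prime] simp_thms)
  finally show ?thesis
    using assms(2) res unfolding gauss_index_def by blast
qed

text \<open>Since 2 is invertible modulo \<open>p\<close>, doubling is injective on residues; an
  injective self-map of a finite set is onto.\<close>

lemma double_bij:
  assumes "p > 2"
  shows "bij_betw (\<lambda>(n, m). ((2 * n) mod p, (2 * m) mod p)) I I" (is "bij_betw ?h I I")
proof -
  have two: "coprime 2 p"
    using assms prime by (metis coprime_commute prime_imp_coprime zdvd_not_zless zero_less_numeral)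
  have inj: "k = l" if "(2 * k) mod p = (2 * l) mod p" "k \<in> {1..p - 1}" "l \<in> {1..p - 1}" for k l
  proof -
    have "p dvd 2 * (k - l)" using that(1) by (simp add: mod_eq_dvd_iff right_diff_distrib)
    then have "p dvd k - l" using two by (metis coprime_commute coprime_dvd_mult_right_iff)
    then have "k mod p = l mod p" by (simp add: mod_eq_dvd_iff)
    then show ?thesis using that by simp
  qed
  have "inj_on ?h I"
    by (rule inj_onI) (auto simp: gauss_index_def intro: inj)
  moreover have "?h ` I \<subseteq> I" using double_index[OF assms] by auto
  ultimately show ?thesis
    by (simp add: bij_betw_def endo_inj_surj finite_gauss_index)
qed

text \<open>Division with remainder gives \<open>2 * z = p * q + z'\<close>, so
  \<open>2 * u - v\<close> is a multiple of \<open>p\<close>, and it is a factor of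
  \<open>16 * u ^ 4 - v ^ 4\<close>.\<close>

lemma double_term:
  assumes "p > 2" "(n, m) \<in> I"
  shows "16 * (1 / gauss_of ((2 * n) mod p, (2 * m) mod p)) ^ 4 - (1 / gauss_of (n, m)) ^ 4 \<in> Id 1"
proof -
  define z where "z = gauss_of (n, m)"
  define z' where "z' = gauss_of ((2 * n) mod p, (2 * m) mod p)"
  define q where "q = gauss_of ((2 * n) div p, (2 * m) div p)"
  define u where "u = 1 / z'"
  define v where "v = 1 / z"
  have nz: "z \<noteq> 0" "z' \<noteq> 0"
    using gauss_of_nonzero double_index[OF assms] assms(2) by (auto simp: z_def z'_def)
  have uv: "u \<in> R" "v \<in> R" "q \<in> R"
    using local_inverse double_index[OF assms] assms(2)
    by (auto simp: z_def z'_def u_def v_def q_def gauss_of_in_gauss_ints gauss_ints_local)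
  have split: "2 * of_int k = (of_int p * of_int ((2 * k) div p) + of_int ((2 * k) mod p) :: complex)"
    for k
  proof -
    have "of_int (2 * k) = (of_int (p * ((2 * k) div p) + (2 * k) mod p) :: complex)"
      by (simp only: mult_div_mod_eq)
    then show ?thesis by (simp only: of_int_add of_int_mult of_int_numeral)
  qed
  have "2 * z = 2 * of_int n + 2 * of_int m * \<i>"
    by (simp add: z_def gauss_of_def distrib_left)
  also have "\<dots> = of_int p * q + z'"
    unfolding split z'_def q_def gauss_of_def prod.case by algebra
  finally have "2 * z - z' = of_int p * q" by simp
  moreover have "2 * u - v = (2 * z - z') * u * v"
    using nz by (simp add: u_def v_def field_simps)
  ultimately have "2 * u - v = of_int p * q * u * v"
    by simp
  moreover have "16 * u ^ 4 - v ^ 4 = (2 * u - v) * ((2 * u + v) * (4 * u\<^sup>2 + v\<^sup>2))"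
    by (simp add: power2_eq_square power4_eq_xxxx algebra_simps)
  ultimately have "16 * u ^ 4 - v ^ 4 = of_int p ^ 1 * (q * u * v * ((2 * u + v) * (4 * u\<^sup>2 + v\<^sup>2)))"
    by (simp only: power_one_right mult.assoc)
  moreover have "\<dots> \<in> Id 1"
    by (intro idealI local_intros uv)
  ultimately show ?thesis by (simp add: u_def v_def z_def z'_def)
qed

lemma gauss_sum_4_ideal:
  assumes "p > 5"
  shows "S 4 \<in> Id 1"
proof -
  let ?h = "\<lambda>(n, m). ((2 * n) mod p, (2 * m) mod p)"
  have p2: "p > 2" using assms by simp
  have "(\<Sum>x\<in>I. (1 / gauss_of (?h x)) ^ 4) = S 4"
    unfolding gauss_sum_eq
    by (rule sum.reindex_bij_betw[OF double_bij[OF p2], where g = "\<lambda>x. (1 / gauss_of x) ^ 4"])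
  \<comment> \<open>The sum over doubled residues is \<open>S 4\<close> itself, so 15 arises as 16 -
    1.\<close>
  then have "of_int 15 * S 4 = 16 * (\<Sum>x\<in>I. (1 / gauss_of (?h x)) ^ 4) - S 4"
    by (simp only:) simp
  also have "\<dots> = (\<Sum>x\<in>I. 16 * (1 / gauss_of (?h x)) ^ 4 - (1 / gauss_of x) ^ 4)"
    by (simp only: sum_subtractf sum_distrib_left gauss_sum_eq)
  also have "\<dots> \<in> Id 1"
    by (rule ideal_sum) (use double_term[OF p2] in \<open>simp only: split_paired_all prod.case\<close>)
  finally have 15: "of_int 15 * S 4 \<in> Id 1" .
  \<comment> \<open>Here \<open>p > 5\<close> matters: 15 = 3 * 5 must be a unit.\<close>
  have "\<not> p dvd 3" "\<not> p dvd 5"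
    using assms by (simp_all add: zdvd_not_zless)
  then have "\<not> p dvd 3 * 5"
    by (simp only: prime_dvd_mult_iff[OF prime] simp_thms)
  then have "\<not> p dvd 15" by simp
  then show ?thesis using 15 by (rule ideal_cancel)
qed

section \<open>Reflections of the index set and their effect on the sums\<close>

abbreviation (input) w where "w \<equiv> of_int p * (1 + \<i>)"

lemma reflect_sum:
  "S k = (\<Sum>x\<in>I. (1 / (w - gauss_of x)) ^ k)"
proof -
  have "S k = (\<Sum>x\<in>I. (1 / gauss_of (case x of (n, m) \<Rightarrow> (p - n, p - m))) ^ k)"
    unfolding gauss_sum_eq
    by (rule sum_involution[symmetric]) (auto intro: gauss_index_reflect_both)
  also have "\<dots> = (\<Sum>x\<in>I. (1 / (w - gauss_of x)) ^ k)"
    by (intro sum.cong) (auto simp: gauss_of_def algebra_simps)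
  finally show ?thesis .
qed

text \<open>The difference is the negative of the reflected point \<open>(p - n, p - m)\<close>,
  which again lies in the index set. The sign is the one in which \<open>shifted_inverse_rec\<close>
  is stated.\<close>

lemma reflect_local:
  assumes "x \<in> I"
  shows "1 / (gauss_of x - w) \<in> R" "gauss_of x - w \<noteq> 0"
proof -
  obtain n m where x: "x = (n, m)" by (cases x)
  have y: "(p - n, p - m) \<in> I" using assms x gauss_index_reflect_both by auto
  have eq: "gauss_of x - w = - gauss_of (p - n, p - m)"
    by (simp add: x gauss_of_def algebra_simps)
  then show "gauss_of x - w \<noteq> 0" using gauss_of_nonzero[OF y] by simp
  show "1 / (gauss_of x - w) \<in> R"
    using local_uminus[OF local_inverse[OF y]] eq by simp
qed

text \<open>Reflecting only the real part \<open>n\<close> sends \<open>z\<close> to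
  \<open>p - cnj z\<close>.\<close>

lemma reflect_conj_sum:
  "S k = (\<Sum>x\<in>I. (1 / (of_int p - cnj (gauss_of x))) ^ k)"
proof -
  have "S k = (\<Sum>x\<in>I. (1 / gauss_of (case x of (n, m) \<Rightarrow> (p - n, m))) ^ k)"
    unfolding gauss_sum_eq
    by (rule sum_involution[symmetric]) (auto intro: gauss_index_reflect)
  also have "\<dots> = (\<Sum>x\<in>I. (1 / (of_int p - cnj (gauss_of x))) ^ k)"
    by (intro sum.cong) (auto simp: gauss_of_def algebra_simps)
  finally show ?thesis .
qed

lemma reflect_conj_local:
  assumes "x \<in> I"
  shows "1 / (cnj (gauss_of x) - of_int p) \<in> R" "cnj (gauss_of x) - of_int p \<noteq> 0"
proof -
  obtain n m where x: "x = (n, m)" by (cases x)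
  have y: "(p - n, m) \<in> I" using assms x gauss_index_reflect by auto
  have eq: "cnj (gauss_of x) - of_int p = - gauss_of (p - n, m)"
    by (simp add: x gauss_of_def algebra_simps)
  then show "cnj (gauss_of x) - of_int p \<noteq> 0" using gauss_of_nonzero[OF y] by simp
  show "1 / (cnj (gauss_of x) - of_int p) \<in> R"
    using local_uminus[OF local_inverse[OF y]] eq by simp
qed

lemma not_dvd_two: "p > 5 \<Longrightarrow> \<not> p dvd 2"
  by (simp add: zdvd_not_zless)

lemma cnj_gauss_sum: "(\<Sum>x\<in>I. (1 / cnj (gauss_of x)) ^ k) = cnj (S k)"
  by (simp add: gauss_sum_eq)

text \<open>Swapping coordinates sends \<open>z\<close> to \<open>\<i> * cnj z\<close>, and squaring
  turns the factor \<open>\<i>\<close> into -1.\<close>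

lemma cnj_gauss_sum_2: "cnj (S 2) = - S 2"
proof -
  have "S 2 = (\<Sum>x\<in>I. (1 / gauss_of (prod.swap x)) ^ 2)"
    unfolding gauss_sum_eq
    by (rule sum_involution[symmetric]) (auto intro: gauss_index_swap)
  also have "\<dots> = (\<Sum>x\<in>I. - ((1 / cnj (gauss_of x)) ^ 2))"
  proof (rule sum.cong[OF refl])
    fix x
    have "gauss_of (prod.swap x) = \<i> * cnj (gauss_of x)"
      by (cases x) (simp add: gauss_of_def complex_eq_iff)
    then show "(1 / gauss_of (prod.swap x)) ^ 2 = - ((1 / cnj (gauss_of x)) ^ 2)"
      by (simp add: power_divide power_mult_distrib)
  qed
  finally have "S 2 = - cnj (S 2)" by (simp only: sum_negf cnj_gauss_sum)
  then show ?thesis by (metis add.inverse_inverse)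
qed

lemma local_one_plus_i: "1 + \<i> \<in> R"
  by (intro local_add local_one local_i)

lemma ideal_w_power: "r \<in> R \<Longrightarrow> w ^ k * r \<in> Id k"
  using ideal_power_mult[OF local_one_plus_i idealI[of r 0], of k] by simp

text \<open>As \<open>1 + \<i>\<close> is local, \<open>w ^ k\<close> raises the ideal exponent by
  \<open>k\<close>. The separate equation for \<open>i\<close> lets numeral exponents be matched by
  arithmetic.\<close>

lemma ideal_w_power_mult: "x \<in> Id j \<Longrightarrow> i = k + j \<Longrightarrow> w ^ k * x \<in> Id i"
  using ideal_power_mult[OF local_one_plus_i, of x j k] by simp

lemma ideal_w_mult: "x \<in> Id j \<Longrightarrow> i = Suc j \<Longrightarrow> w * x \<in> Id i"
  using ideal_w_power_mult[of x j i 1] by simp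

lemma ideal_p_mult: "x \<in> Id j \<Longrightarrow> i = k + j \<Longrightarrow> of_int p ^ k * x \<in> Id i"
  using ideal_power_mult[OF local_one, of x j k] by simp

section \<open>Descent from exponent 4 to exponents 3, 2 and 1\<close>

lemma gauss_sum_3_ideal:
  assumes "p > 5"
  shows "S 3 \<in> Id 2"
proof -
  let ?u = "\<lambda>x. 1 / gauss_of x"
  let ?v = "\<lambda>x. 1 / (gauss_of x - w)"
  let ?r = "\<lambda>x. 5 * ?u x ^ 4 * ?v x + 2 * w * ?u x ^ 4 * (?v x)\<^sup>2 + (?u x)\<^sup>2 * ?v x ^ 3"
  \<comment> \<open>The minus sign comes from the odd exponent, as \<open>?v\<close> inverts the
    negative of \<open>w - z\<close>.\<close>
  have "- S 3 = (\<Sum>x\<in>I. ?v x ^ 3)"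
    unfolding reflect_sum[of 3] sum_negf[symmetric]
    by (intro sum.cong refl) (metis minus_diff_eq divide_minus_right power_minus_odd odd_numeral
        add.inverse_inverse)
  also have "\<dots> = (\<Sum>x\<in>I. ?u x ^ 3 + 3 * w * ?u x ^ 4 + w\<^sup>2 * ?r x)"
    by (intro sum.cong refl shifted_inverse_expand3 shifted_inverse_rec gauss_of_nonzero reflect_local)
  also have "\<dots> = S 3 + (3 * (w * S 4) + (\<Sum>x\<in>I. w\<^sup>2 * ?r x))"
    by (simp only: gauss_sum_eq sum.distrib sum_distrib_left add.assoc mult.assoc)
  finally have "of_int 2 * S 3 = - (3 * (w * S 4) + (\<Sum>x\<in>I. w\<^sup>2 * ?r x))"
    by (rule double_eq_of_uminus_eq)
  moreover have "3 * (w * S 4) \<in> Id 2"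
    by (intro ideal_mult local_numeral ideal_w_mult[OF gauss_sum_4_ideal[OF assms]]) simp
  moreover have "(\<Sum>x\<in>I. w\<^sup>2 * ?r x) \<in> Id 2"
    by (intro ideal_sum ideal_w_power local_intros reflect_local local_one_plus_i)
  ultimately have "of_int 2 * S 3 \<in> Id 2"
    by (simp only:) (intro ideal_uminus ideal_add)
  then show ?thesis by (rule ideal_cancel[OF not_dvd_two[OF assms]])
qed

text \<open>For an even exponent the reflection in \<open>w\<close> would put \<open>S 2\<close> on
  both sides with the same sign, where it cancels. The conjugate reflection puts
  \<open>cnj (S 2)\<close> on the right instead.\<close>

lemma gauss_sum_2_ideal:
  assumes "p > 5"
  shows "S 2 \<in> Id 3"
proof -
  let ?u = "\<lambda>x. 1 / cnj (gauss_of x)"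
  let ?v = "\<lambda>x. 1 / (cnj (gauss_of x) - of_int p)"
  let ?r = "\<lambda>x. 3 * ?u x ^ 4 * ?v x + ?u x ^ 3 * (?v x)\<^sup>2"
  have u: "?u x \<in> R" if "x \<in> I" for x
    using local_cnj[OF local_inverse[OF that]] by simp
  have "S 2 = (\<Sum>x\<in>I. (?v x)\<^sup>2)"
    unfolding reflect_conj_sum[of 2]
    by (intro sum.cong refl) (metis minus_diff_eq divide_minus_right power2_minus)
  also have "\<dots> = (\<Sum>x\<in>I. (?u x)\<^sup>2 + 2 * of_int p * ?u x ^ 3 + 3 * (of_int p)\<^sup>2 * ?u x ^ 4
      + of_int p ^ 3 * ?r x)"
    by (intro sum.cong refl shifted_inverse_expand2 shifted_inverse_rec reflect_conj_local)
      (simp add: gauss_of_nonzero)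
  also have "\<dots> = cnj (S 2) + 2 * of_int p * cnj (S 3) + 3 * (of_int p)\<^sup>2 * cnj (S 4)
      + (\<Sum>x\<in>I. of_int p ^ 3 * ?r x)"
    by (simp only: cnj_gauss_sum[symmetric] sum.distrib sum_distrib_left)
  \<comment> \<open>Replacing \<open>cnj (S 2)\<close> by \<open>- S 2\<close> and moving it to the
    left doubles \<open>S 2\<close>.\<close>
  finally have "of_int 2 * S 2 = 2 * (of_int p ^ 1 * cnj (S 3)) + 3 * ((of_int p)\<^sup>2 * cnj (S 4))
      + (\<Sum>x\<in>I. of_int p ^ 3 * ?r x)"
    by (simp add: cnj_gauss_sum_2)
  moreover have "2 * (of_int p ^ 1 * cnj (S 3)) \<in> Id 3"
    by (rule ideal_mult[OF local_numeral ideal_p_mult[OF ideal_cnj[OF gauss_sum_3_ideal[OF assms]]]]) simp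
  moreover have "3 * ((of_int p)\<^sup>2 * cnj (S 4)) \<in> Id 3"
    by (rule ideal_mult[OF local_numeral ideal_p_mult[OF ideal_cnj[OF gauss_sum_4_ideal[OF assms]]]]) simp
  moreover have "(\<Sum>x\<in>I. of_int p ^ 3 * ?r x) \<in> Id 3"
    by (intro ideal_sum idealI local_add local_mult local_power local_numeral u reflect_conj_local)
  ultimately have "of_int 2 * S 2 \<in> Id 3"
    by (simp only:) (intro ideal_add)
  then show ?thesis by (rule ideal_cancel[OF not_dvd_two[OF assms]])
qed

lemma gauss_sum_1_ideal:
  assumes "p > 5"
  shows "S 1 \<in> Id 4"
proof -
  let ?u = "\<lambda>x. 1 / gauss_of x"
  let ?v = "\<lambda>x. 1 / (gauss_of x - w)"
  let ?r = "\<lambda>x. ?u x ^ 4 * ?v x"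
  have "- S 1 = (\<Sum>x\<in>I. ?v x)"
    unfolding reflect_sum[of 1] sum_negf[symmetric]
    by (intro sum.cong refl) (metis minus_diff_eq divide_minus_right power_one_right)
  also have "\<dots> = (\<Sum>x\<in>I. ?u x + w * (?u x)\<^sup>2 + w\<^sup>2 * ?u x ^ 3 + w ^ 3 * ?u x ^ 4 + w ^ 4 * ?r x)"
    by (intro sum.cong refl shifted_inverse_expand1 shifted_inverse_rec gauss_of_nonzero reflect_local)
  also have "\<dots> = S 1 + (w * S 2 + w\<^sup>2 * S 3 + w ^ 3 * S 4 + (\<Sum>x\<in>I. w ^ 4 * ?r x))"
    by (simp only: gauss_sum_eq sum.distrib sum_distrib_left power_one_right add.assoc)
  finally have "of_int 2 * S 1 = - (w * S 2 + w\<^sup>2 * S 3 + w ^ 3 * S 4 + (\<Sum>x\<in>I. w ^ 4 * ?r x))"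
    by (rule double_eq_of_uminus_eq)
  \<comment> \<open>The exponents balance term by term: 1 + 3, 2 + 2, 3 + 1, and 4 + 0 for the
    remainder.\<close>
  moreover have "w * S 2 \<in> Id 4"
    by (rule ideal_w_mult[OF gauss_sum_2_ideal[OF assms]]) simp
  moreover have "w\<^sup>2 * S 3 \<in> Id 4"
    by (rule ideal_w_power_mult[OF gauss_sum_3_ideal[OF assms]]) simp
  moreover have "w ^ 3 * S 4 \<in> Id 4"
    by (rule ideal_w_power_mult[OF gauss_sum_4_ideal[OF assms]]) simp
  moreover have "(\<Sum>x\<in>I. w ^ 4 * ?r x) \<in> Id 4"
    by (intro ideal_sum ideal_w_power local_mult local_power local_inverse reflect_local)
  ultimately have "of_int 2 * S 1 \<in> Id 4"
    by (simp only:) (intro ideal_uminus ideal_add)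
  then show ?thesis by (rule ideal_cancel[OF not_dvd_two[OF assms]])
qed

end

theorem theorem2:
  fixes p :: int
  assumes "prime p" and "p > 5"
  shows "gauss_cong p 4 (gauss_sum p 1) 0
       \<and> gauss_cong p 3 (gauss_sum p 2) 0
       \<and> gauss_cong p 2 (gauss_sum p 3) 0
       \<and> gauss_cong p 1 (gauss_sum p 4) 0"
proof -
  interpret gauss_prime p by standard (rule assms(1))
  show ?thesis
    by (intro conjI gauss_cong_zero gauss_sum_1_ideal gauss_sum_2_ideal gauss_sum_3_ideal gauss_sum_4_ideal assms(2))
qed

end
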